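(* Let $\xi\in\mathbb{B}$ satisfy $\xi^2=-1$. Then each of the biquaternions $q=\frac12+\frac12\xi I$ and $q=\frac12-\frac12\xi I$ is an idempotent, i.e. $q^2=q$. Moreover there are no other idempotents in $\mathbb{B}$: every $q\in\mathbb{B}$ with $q^2=q$ is of the form $q=\frac12\pm\frac12\xi I$ for some $\xi\in\mathbb{B}$ with $\xi^2=-1$.
   Context: $\mathbb{B}$ denotes the algebra of biquaternions (quaternions with complex coefficients), whose elements are $q=W+X\boldsymbol{i}+Y\boldsymbol{j}+Z\boldsymbol{k}$ with $W,X,Y,Z\in\mathbb{C}$, where $\boldsymbol{i},\boldsymbol{j},\boldsymbol{k}$ are the usual quaternion units. The square root of $-1$ in $\mathbb{C}$ is denoted $I$; it is distinct from $\boldsymbol{i}$ and commutes with $\boldsymbol{i},\boldsymbol{j},\boldsymbol{k}$, hence with all biquaternions. A root of $-1$ in $\mathbb{B}$ is any $\xi\in\mathbb{B}$ with $\xi^2=-1$; this includes the trivial roots $\xi=\pm I$ (which yield the trivial idempotents $0$ and $1$). An idempotent is an element $q$ with $q^2=q$. *)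

theory Defs
  imports Complex_Main
begin

datatype biquaternion =
  Biquaternion (bqW: complex) (bqX: complex) (bqY: complex) (bqZ: complex)

lemma biquaternion_eq_iff:
  "p = q \<longleftrightarrow> bqW p = bqW q \<and> bqX p = bqX q \<and> bqY p = bqY q \<and> bqZ p = bqZ q"
  by (auto intro: biquaternion.expand)

instantiation biquaternion :: ring_1
begin

definition "0 = Biquaternion 0 0 0 0"

definition "1 = Biquaternion 1 0 0 0"

definition "p + q = Biquaternion (bqW p + bqW q) (bqX p + bqX q) (bqY p + bqY q) (bqZ p + bqZ q)"

definition "- p = Biquaternion (- bqW p) (- bqX p) (- bqY p) (- bqZ p)"

definition "p - q = Biquaternion (bqW p - bqW q) (bqX p - bqX q) (bqY p - bqY q) (bqZ p - bqZ q)"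

text \<open>The Hamilton product, extended bilinearly over the complex numbers.\<close>

definition "p * q = Biquaternion
   (bqW p * bqW q - bqX p * bqX q - bqY p * bqY q - bqZ p * bqZ q)
   (bqW p * bqX q + bqX p * bqW q + bqY p * bqZ q - bqZ p * bqY q)
   (bqW p * bqY q - bqX p * bqZ q + bqY p * bqW q + bqZ p * bqX q)
   (bqW p * bqZ q + bqX p * bqY q - bqY p * bqX q + bqZ p * bqW q)"

lemmas biquaternion_arith_defs =
  zero_biquaternion_def one_biquaternion_def plus_biquaternion_def
  uminus_biquaternion_def minus_biquaternion_def times_biquaternion_def

instance
  by standard (simp_all add: biquaternion_arith_defs algebra_simps)

end

definition biq_of_complex :: "complex \<Rightarrow> biquaternion" where
  "biq_of_complex c = Biquaternion c 0 0 0"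

text \<open>The complex root of \<open>-1\<close>, as opposed to the quaternion unit \<open>biq_i\<close>.\<close>

definition biq_I :: biquaternion where "biq_I = biq_of_complex \<i>"

definition biq_i :: biquaternion where "biq_i = Biquaternion 0 1 0 0"
definition biq_j :: biquaternion where "biq_j = Biquaternion 0 0 1 0"
definition biq_k :: biquaternion where "biq_k = Biquaternion 0 0 0 1"

lemmas biq_basis_defs = biq_of_complex_def biq_I_def biq_i_def biq_j_def biq_k_def

lemma biquaternion_decomp:
  "Biquaternion w x y z =
     biq_of_complex w + biq_of_complex x * biq_i + biq_of_complex y * biq_j + biq_of_complex z * biq_k"
  by (simp add: biq_basis_defs biquaternion_arith_defs)

lemma biq_of_complex_hom:
  "biq_of_complex 0 = 0" "biq_of_complex 1 = 1"
  "biq_of_complex (c + d) = biq_of_complex c + biq_of_complex d"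
  "biq_of_complex (c * d) = biq_of_complex c * biq_of_complex d"
  by (simp_all add: biq_basis_defs biquaternion_arith_defs)

lemma biq_of_complex_central: "biq_of_complex c * q = q * biq_of_complex c"
  by (simp add: biq_basis_defs biquaternion_arith_defs mult.commute)

lemma biq_I_squared: "biq_I\<^sup>2 = - 1"
  by (simp add: power2_eq_square biq_basis_defs biquaternion_arith_defs)

lemma biq_unit_products:
  "biq_i\<^sup>2 = - 1" "biq_j\<^sup>2 = - 1" "biq_k\<^sup>2 = - 1"
  "biq_i * biq_j = biq_k" "biq_j * biq_k = biq_i" "biq_k * biq_i = biq_j"
  "biq_j * biq_i = - biq_k" "biq_k * biq_j = - biq_i" "biq_i * biq_k = - biq_j"
  by (simp_all add: power2_eq_square biq_basis_defs biquaternion_arith_defs)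

end

theory Submission
  imports Defs
begin

text \<open>
  With \<open>\<sigma> = \<xi>I\<close>, the condition \<open>\<xi>\<^sup>2 = -1\<close> becomes \<open>\<sigma>\<^sup>2 = 1\<close>, because \<open>I\<close> is central. Idempotents \<open>q\<close> and
  involutions \<open>\<sigma>\<close> correspond to each other through \<open>\<sigma> = 2q - 1\<close>, so \<open>\<xi> = (1 - 2q)I\<close>.
\<close>

lemma biq_half_plus_half: "biq_of_complex (1/2) + biq_of_complex (1/2) = 1"
  by (simp flip: biq_of_complex_hom)

text \<open>Replaces division by 2: doubling is written as \<open>q + q\<close>, and this law
  cancels it against the factor 1/2.\<close>

lemma biq_half_add_half_mult: "biq_of_complex (1/2) * q + biq_of_complex (1/2) * q = q"
  by (metis biq_half_plus_half distrib_right mult_1)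

lemma biq_I_central: "biq_I * q = q * biq_I"
  by (simp add: biq_I_def biq_of_complex_central)

text \<open>Centrality brings the two factors I together. The result turns roots of -1 into
  involutions and back.\<close>

lemma square_mult_biq_I: "(q * biq_I)\<^sup>2 = - (q\<^sup>2)"
proof -
  have "(q * biq_I)\<^sup>2 = q * (biq_I * q) * biq_I"
    by (simp add: power2_eq_square mult.assoc)
  also have "\<dots> = q\<^sup>2 * biq_I\<^sup>2"
    by (simp only: biq_I_central [of q] power2_eq_square mult.assoc)
  finally show ?thesis
    by (simp add: biq_I_squared)
qed

text \<open>If s squares to 1, then (1 + s)^2 = 2(1 + s), so one of the two factors 1/2 in the
  square is absorbed.\<close>

lemma idempotent_of_involution:
  assumes "s\<^sup>2 = 1"
  shows "(biq_of_complex (1/2) + biq_of_complex (1/2) * s)\<^sup>2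
           = biq_of_complex (1/2) + biq_of_complex (1/2) * s"
proof -
  let ?h = "biq_of_complex (1/2)"
  \<comment> \<open>The bracketing isolates the one product that has to be commuted, which
    centrality of 1/2 allows.\<close>
  have "(?h + ?h * s)\<^sup>2 = ?h * ((1 + s) * ?h) * (1 + s)"
    by (simp add: power2_eq_square distrib_left distrib_right mult.assoc)
  also have "\<dots> = ?h * (?h * ((1 + s) * (1 + s)))"
    by (simp only: biq_of_complex_central [of _ "1 + s", symmetric] mult.assoc)
  also have "(1 + s) * (1 + s) = (1 + s) + (1 + s)"
    using assms by (simp add: power2_eq_square algebra_simps)
  also have "?h * (\<dots>) = 1 + s"
    by (simp only: distrib_left [of ?h "1 + s"] biq_half_add_half_mult)
  finally show ?thesis
    by (simp add: distrib_left)
qed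

text \<open>The square expands to 1 - 4q + 4q^2, whose last two terms cancel.\<close>

lemma involution_of_idempotent:
  fixes q :: "'a::ring_1"
  assumes "q\<^sup>2 = q"
  shows "(1 - (q + q))\<^sup>2 = 1"
  using assms by (simp add: power2_eq_square algebra_simps)

theorem theorem2:
  shows "(\<forall>\<xi> :: biquaternion. \<xi>\<^sup>2 = - 1 \<longrightarrow>
            (biq_of_complex (1/2) + biq_of_complex (1/2) * \<xi> * biq_I)\<^sup>2
              = biq_of_complex (1/2) + biq_of_complex (1/2) * \<xi> * biq_I \<and>
            (biq_of_complex (1/2) - biq_of_complex (1/2) * \<xi> * biq_I)\<^sup>2
              = biq_of_complex (1/2) - biq_of_complex (1/2) * \<xi> * biq_I) \<and>
         (\<forall>q :: biquaternion. q\<^sup>2 = q \<longrightarrow>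
            (\<exists>\<xi> :: biquaternion. \<xi>\<^sup>2 = - 1 \<and>
               (q = biq_of_complex (1/2) + biq_of_complex (1/2) * \<xi> * biq_I \<or>
                q = biq_of_complex (1/2) - biq_of_complex (1/2) * \<xi> * biq_I)))"
proof (intro conjI allI impI)
  fix \<xi> :: biquaternion
  assume "\<xi>\<^sup>2 = - 1"
  \<comment> \<open>The form with the minus sign comes from the opposite involution.\<close>
  then have "(\<xi> * biq_I)\<^sup>2 = 1" and "(- (\<xi> * biq_I))\<^sup>2 = 1"
    by (simp_all add: square_mult_biq_I)
  from this[THEN idempotent_of_involution]
  show "(biq_of_complex (1/2) + biq_of_complex (1/2) * \<xi> * biq_I)\<^sup>2
          = biq_of_complex (1/2) + biq_of_complex (1/2) * \<xi> * biq_I"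
    and "(biq_of_complex (1/2) - biq_of_complex (1/2) * \<xi> * biq_I)\<^sup>2
          = biq_of_complex (1/2) - biq_of_complex (1/2) * \<xi> * biq_I"
    by (simp_all add: mult.assoc)
next
  fix q :: biquaternion
  assume q: "q\<^sup>2 = q"
  let ?h = "biq_of_complex (1/2)" and ?\<xi> = "(1 - (q + q)) * biq_I"
  have "?\<xi>\<^sup>2 = - 1"
    by (simp add: square_mult_biq_I involution_of_idempotent q)
  \<comment> \<open>The plus sign always suffices, since replacing \<xi> by -\<xi> exchanges the two
    forms.\<close>
  moreover have "q = ?h + ?h * ?\<xi> * biq_I"
  proof -
    have "?\<xi> * biq_I = (q + q) - 1"
      using biq_I_squared by (simp add: power2_eq_square mult.assoc)
    then have "?h + ?h * ?\<xi> * biq_I = ?h * q + ?h * q"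
      by (simp add: mult.assoc right_diff_distrib distrib_left)
    then show ?thesis
      by (simp add: biq_half_add_half_mult)
  qed
  ultimately show "\<exists>\<xi>. \<xi>\<^sup>2 = - 1 \<and> (q = ?h + ?h * \<xi> * biq_I \<or> q = ?h - ?h * \<xi> * biq_I)"
    by blast
qed

end
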